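(* Let $\Omega\subset\mathbb R^d$ ($d\ge2$) be a uniformly convex domain with nodal set $\mathcal N_h=\mathcal N_h^0\cup\mathcal N_h^\partial$. Let $v_h,w_h:\mathcal N_h\to\mathbb R$ be two nodal functions such that $v_h(x_i)\ge w_h(x_i)$ for all $x_i\in\mathcal N_h^\partial$. Then $$\sup_{\mathcal N_h}(v_h-w_h)^-\le C\left(\sum_{x_i\in\mathcal C_h^-(v_h-w_h)}\Big(|\partial v_h(x_i)|^{1/d}-|\partial w_h(x_i)|^{1/d}\Big)^d\right)^{1/d},$$ where $C=C(d,\Omega)$ is proportional to the diameter of $\Omega$.
   Context: $\mathcal N_h=\mathcal N_h^0\cup\mathcal N_h^\partial$ is a finite set of nodes, $\mathcal N_h^0\subset\Omega$ (interior nodes) and $\mathcal N_h^\partial\subset\partial\Omega$ (boundary nodes), which is the vertex set of a conforming simplicial mesh $\mathcal T_h$; $\Omega_h=\bigcup_{T\in\mathcal T_h}T\subset\overline\Omega$. A nodal function is a map $\mathcal N_h\to\mathbb R$. The subdifferential of a nodal function $v_h$ at $x_i$ is $\partial v_h(x_i)=\{v\in\mathbb R^d:v_h(x_j)\ge v_h(x_i)+v\cdot(x_j-x_i)\ \forall x_j\in\mathcal N_h\}$, and $|\cdot|$ of a set denotes $d$-dimensional Lebesgue measure. The convex envelope is $\Gamma(v_h)(x)=\sup\{L(x):L\text{ affine},\ L(x_i)\le v_h(x_i)\ \forall x_i\in\mathcal N_h\}$ for $x\in\Omega_h$, and the (lower nodal) contact set is $\mathcal C_h^-(v_h)=\{x_i\in\mathcal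 N_h^0:\Gamma(v_h)(x_i)=v_h(x_i)\}$. The negative part is $a^-=\max\{-a,0\}$.
   Formalization: The formal theorem also assumes that ∂w_h(x_i) is nonempty at every node of the contact set of v_h − w_h (automatic for convex w_h; the claim is false without it), and that interior nodes lie in the interior of Ω_h (otherwise subdifferentials can have infinite measure). *)

theory Defs
  imports "HOL-Analysis.Analysis"
begin

(* Enclosing-ball form of uniform convexity: one radius R serves all boundary points. It assumes
   no regularity of the boundary; bounded convex C^2 domains whose principal curvatures are
   bounded below by a positive constant satisfy it. *)
definition uniformly_convex_domain :: "(real ^ 'n) set \<Rightarrow> bool" where
  "uniformly_convex_domain \<Omega> \<longleftrightarrow>
     open \<Omega> \<and> \<Omega> \<noteq> {} \<and> bounded \<Omega> \<and> convex \<Omega> \<and>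
     (\<exists>R>0. \<forall>x\<in>frontier \<Omega>. \<exists>z. dist z x = R \<and> \<Omega> \<subseteq> ball z R)"

(* triangulation contains conformity (two simplices meet in a common, possibly empty, face) but
   allows simplices of any dimension, so full dimension is required separately. Interior nodes are
   interior to the meshed region as well as to the domain: all vertices on the boundary of the
   meshed region are boundary nodes. *)
definition nodal_mesh ::
  "(real ^ 'n) set \<Rightarrow> (real ^ 'n) set set \<Rightarrow> (real ^ 'n) set \<Rightarrow> (real ^ 'n) set \<Rightarrow> bool" where
  "nodal_mesh \<Omega> \<T> N0 Nb \<longleftrightarrow>
     triangulation \<T> \<and> \<T> \<noteq> {} \<and> (\<forall>T\<in>\<T>. int CARD('n) simplex T) \<and>
     \<Union>\<T> \<subseteq> closure \<Omega> \<and>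
     N0 \<union> Nb = {x. \<exists>T\<in>\<T>. x extreme_point_of T} \<and>
     N0 \<subseteq> \<Omega> \<and> N0 \<subseteq> interior (\<Union>\<T>) \<and> Nb \<subseteq> frontier \<Omega>"

(* Nodal functions are total functions of which only the values on the node set N are used.
   The subdifferential may be empty, and its measure is then 0; an interior node with w = 10, v = 9
   and v = w = 0 on the boundary nodes shows that a bound of sup (v - w)^- by differences
   of measures of subdifferentials needs nonempty subdifferentials of w at contact nodes. *)
definition subdifferential ::
  "(real ^ 'n) set \<Rightarrow> (real ^ 'n \<Rightarrow> real) \<Rightarrow> real ^ 'n \<Rightarrow> (real ^ 'n) set" where
  "subdifferential N v x = {p. \<forall>y\<in>N. v y \<ge> v x + p \<bullet> (y - x)}"

(* The supremum runs over the values at x of affine minorants z |-> p . z + c; this set is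
   nonempty and bounded above when N is finite and x lies in its convex hull. *)
definition convex_envelope ::
  "(real ^ 'n) set \<Rightarrow> (real ^ 'n \<Rightarrow> real) \<Rightarrow> real ^ 'n \<Rightarrow> real" where
  "convex_envelope N v x = Sup {p \<bullet> x + c | p c. \<forall>y\<in>N. p \<bullet> y + c \<le> v y}"

definition contact_set ::
  "(real ^ 'n) set \<Rightarrow> (real ^ 'n) set \<Rightarrow> (real ^ 'n \<Rightarrow> real) \<Rightarrow> (real ^ 'n) set" where
  "contact_set N0 Nb v = {x\<in>N0. convex_envelope (N0 \<union> Nb) v x = v x}"

definition neg_part :: "real \<Rightarrow> real" where
  "neg_part a = max (- a) 0"

end

theory Submission
  imports Defs
begin

text \<open>
  Put \<open>u = v - w\<close>. If \<open>u x\<^sub>0 = -m < 0\<close> and \<open>u \<ge> 0\<close> on the boundary nodes, then for \<open>|p| < m / D\<close>,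
  where \<open>D\<close> is the diameter, the minimum of \<open>u y - p \<bullet> y\<close> over the nodes is attained at an interior
  node, which is then a contact node with \<open>p\<close> in its subdifferential. So the subdifferentials of \<open>u\<close> at
  the contact nodes cover a ball of radius \<open>m / D\<close>. At a contact node the Minkowski sum
  \<open>\<partial>u + \<partial>w\<close> lies in \<open>\<partial>v\<close>, and the Brunn--Minkowski inequality bounds \<open>|\<partial>u|\<close> by
  the \<open>d\<close>-th power of \<open>|\<partial>v|\<^bsup>1/d\<^esup> - |\<partial>w|\<^bsup>1/d\<^esup>\<close>. Brunn--Minkowski is proved by the
  Hadwiger--Ohmann argument: AM-GM for two boxes, induction for finite unions of boxes, approximation
  for compact sets.
\<close>

section \<open>The Brunn--Minkowski inequality\<close>

lemma compact_set_plus: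
  fixes A B :: "'a::real_normed_vector set"
  assumes "compact A" "compact B"
  shows "compact (A + B)"
proof -
  have "A + B = {x + y | x y. x \<in> A \<and> y \<in> B}"
    by (auto simp: set_plus_def)
  then show ?thesis
    using compact_sums[OF assms] by simp
qed

text \<open>The two closed pieces overlap only in a coordinate hyperplane, which is null.\<close>

lemma measure_halfspace_split:
  fixes S :: "'a::euclidean_space set"
  assumes "S \<in> lmeasurable" and i: "i \<in> Basis"
  shows "measure lebesgue S =
    measure lebesgue (S \<inter> {x. x \<bullet> i \<le> c}) + measure lebesgue (S \<inter> {x. c \<le> x \<bullet> i})"
proof -
  have cl: "closed {x. x \<bullet> i \<le> c}" "closed {x. c \<le> x \<bullet> i}"
    by (auto intro!: closed_Collect_le continuous_intros)
  have ms: "S \<inter> {x. x \<bullet> i \<le> c} \<in> lmeasurable" "S \<inter> {x. c \<le> x \<bullet> i} \<in> lmeasurable"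
    using assms(1) cl by (auto intro!: fmeasurable_Int_fmeasurable borel_closed)
  have neg: "negligible ((S \<inter> {x. x \<bullet> i \<le> c}) \<inter> (S \<inter> {x. c \<le> x \<bullet> i}))"
    by (rule negligible_subset[OF negligible_standard_hyperplane[OF i, of c]]) auto
  have "measure lebesgue (S \<inter> {x. c \<le> x \<bullet> i} - S \<inter> {x. x \<bullet> i \<le> c})
      = measure lebesgue (S \<inter> {x. c \<le> x \<bullet> i})"
    by (rule measure_negligible_symdiff[OF ms(2)], rule negligible_subset[OF neg]) auto
  moreover have "S \<inter> {x. x \<bullet> i \<le> c} \<union> S \<inter> {x. c \<le> x \<bullet> i} = S"
    by auto
  ultimately show ?thesis
    using measure_Un2[OF ms] by simp
qed

text \<open>Moving the threshold near \<open>c\<close> changes the slice only inside a thin slab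
  around \<open>c\<close>, whose content within a bounding box is small. Continuity lets a
  hyperplane be chosen that cuts off a prescribed share of the volume.\<close>

lemma continuous_on_measure_halfspace:
  fixes S :: "'a::euclidean_space set"
  assumes "compact S" and i: "i \<in> Basis"
  shows "continuous_on UNIV (\<lambda>t. measure lebesgue (S \<inter> {x. x \<bullet> i \<le> t}))"
proof -
  obtain a b where ab: "S \<subseteq> cbox a b"
    using bounded_subset_cbox_symmetric compact_imp_bounded[OF assms(1)] by blast
  have meas: "S \<inter> {x. x \<bullet> i \<le> t} \<in> lmeasurable" for t
    by (intro lmeasurable_compact compact_Int_closed assms closed_Collect_le continuous_intros)
  have "\<exists>d>0. \<forall>t. \<bar>t - c\<bar> < d \<longrightarrow>
      \<bar>measure lebesgue (S \<inter> {x. x \<bullet> i \<le> t}) - measure lebesgue (S \<inter> {x. x \<bullet> i \<le> c})\<bar> < e"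
    if e: "e > 0" for c e
  proof -
    obtain d where "d > 0" and d: "measure lborel (cbox a b \<inter> {x. \<bar>x \<bullet> i - c\<bar> \<le> d}) < e"
      using content_doublesplit[OF e i, of a b c] by blast
    have d: "d > 0" "measure lebesgue (cbox a b \<inter> {x. \<bar>x \<bullet> i - c\<bar> \<le> d}) < e"
      using \<open>d > 0\<close> d by (simp_all add: interval_doublesplit[OF i])
    have mslab: "cbox a b \<inter> {x. \<bar>x \<bullet> i - c\<bar> \<le> d} \<in> lmeasurable"
      by (intro lmeasurable_compact compact_Int_closed compact_cbox closed_Collect_le continuous_intros)
    \<comment> \<open>Stated for two free thresholds, so that swapping them gives both directions of
      the absolute value.\<close>
    have le: "measure lebesgue (S \<inter> {x. x \<bullet> i \<le> t})
        \<le> measure lebesgue (S \<inter> {x. x \<bullet> i \<le> s}) + measure lebesgue (cbox a b \<inter> {x. \<bar>x \<bullet> i - c\<bar> \<le> d})"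
      if "\<bar>t - c\<bar> < d" "\<bar>s - c\<bar> < d" for s t
    proof -
      have "S \<inter> {x. x \<bullet> i \<le> t} \<subseteq> S \<inter> {x. x \<bullet> i \<le> s} \<union> cbox a b \<inter> {x. \<bar>x \<bullet> i - c\<bar> \<le> d}"
        using ab that by auto
      then have "measure lebesgue (S \<inter> {x. x \<bullet> i \<le> t})
          \<le> measure lebesgue (S \<inter> {x. x \<bullet> i \<le> s} \<union> cbox a b \<inter> {x. \<bar>x \<bullet> i - c\<bar> \<le> d})"
        by (intro measure_mono_fmeasurable fmeasurable.Un meas mslab fmeasurableD)
      also have "\<dots> \<le> measure lebesgue (S \<inter> {x. x \<bullet> i \<le> s}) + measure lebesgue (cbox a b \<inter> {x. \<bar>x \<bullet> i - c\<bar> \<le> d})"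
        by (intro measure_Un_le fmeasurableD meas mslab)
      finally show ?thesis .
    qed
    show ?thesis
    proof (intro exI[of _ d] conjI allI impI d)
      fix t assume "\<bar>t - c\<bar> < d"
      then show "\<bar>measure lebesgue (S \<inter> {x. x \<bullet> i \<le> t}) - measure lebesgue (S \<inter> {x. x \<bullet> i \<le> c})\<bar> < e"
        using le[of t c] le[of c t] d by auto
    qed
  qed
  then show ?thesis
    by (simp add: continuous_on_iff dist_real_def)
qed

section \<open>Finite families of boxes and their cuts by halfspaces\<close>

text \<open>Closed boxes may share faces, so that cuts by closed halfspaces stay in the class up to
  null pieces. Nondegeneracy gives every nonempty family positive volume.\<close>

definition box_family :: "'a::euclidean_space set set \<Rightarrow> bool" where
  "box_family P \<longleftrightarrow> finite P \<and> (\<forall>K\<in>P. interior K \<noteq> {} \<and> (\<exists>a b. K = cbox a b)) \<and>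
     pairwise (\<lambda>K L. interior K \<inter> interior L = {}) P"

lemma box_familyE:
  assumes "box_family P" "K \<in> P"
  obtains a b where "K = cbox a b" "interior K \<noteq> {}"
proof -
  have "\<forall>K\<in>P. interior K \<noteq> {} \<and> (\<exists>a b. K = cbox a b)"
    using assms(1) by (simp add: box_family_def)
  from bspec[OF this assms(2)] show thesis
    using that by blast
qed

lemma compact_box_family: "box_family P \<Longrightarrow> compact (\<Union>P)"
  by (rule compact_Union) (auto simp: box_family_def)

lemma measure_pos_if_interior:
  fixes S :: "'a::euclidean_space set"
  assumes "S \<in> lmeasurable" "interior S \<noteq> {}"
  shows "measure lebesgue S > 0"
proof -
  have "\<not> negligible S"
    using assms(2) negligible_subset[OF _ interior_subset] open_not_negligible[OF open_interior] by blast
  then show ?thesis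
    using assms(1) by (simp add: negligible_iff_measure0 zero_less_measure_iff)
qed

lemma measure_box_family_pos:
  assumes "box_family P" "P \<noteq> {}"
  shows "measure lebesgue (\<Union>P) > 0"
proof (rule measure_pos_if_interior)
  show "\<Union>P \<in> lmeasurable"
    using assms compact_box_family lmeasurable_compact by blast
  obtain K where "K \<in> P" using assms by auto
  then have "interior K \<subseteq> interior (\<Union>P)" "interior K \<noteq> {}"
    using assms by (auto simp: box_family_def intro!: interior_mono)
  then show "interior (\<Union>P) \<noteq> {}" by auto
qed

text \<open>\<open>H\<close> stands for a closed halfspace orthogonal to an axis; all that matters
  is that it meets boxes in boxes. Degenerate pieces are dropped at the cost of a null set, and each
  one dropped lowers the cardinality, which drives the later induction.\<close>

lemma box_family_cut:
  assumes P: "box_family P"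
    and box: "\<And>a b. \<exists>a' b'. cbox a b \<inter> H = cbox a' b'"
  obtains Q where "box_family Q" "\<Union>Q \<subseteq> \<Union>P \<inter> H"
    "measure lebesgue (\<Union>Q) = measure lebesgue (\<Union>P \<inter> H)"
    "\<forall>K\<in>P. interior (K \<inter> H) = {} \<longrightarrow> card Q < card P" "card Q \<le> card P"
proof -
  define R where "R = {K\<in>P. interior (K \<inter> H) \<noteq> {}}"
  define Q where "Q = (\<lambda>K. K \<inter> H) ` R"
  have fin: "finite P" "finite R" and R: "R \<subseteq> P" using P by (auto simp: box_family_def R_def)
  have boxP: "\<exists>a b. K \<inter> H = cbox a b" if K: "K \<in> P" for K
  proof -
    obtain a b where "K = cbox a b"
      using box_familyE[OF P K] .
    then show ?thesis using box by simp
  qed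
  have cardQ: "card Q \<le> card R" unfolding Q_def using fin by (simp add: card_image_le)
  show thesis
  proof (rule that)
    show "box_family Q"
      unfolding box_family_def
    proof (intro conjI ballI)
      show "finite Q" using fin by (simp add: Q_def)
      show "interior K \<noteq> {}" if "K \<in> Q" for K
        using that by (auto simp: Q_def R_def)
      show "\<exists>a b. K = cbox a b" if "K \<in> Q" for K
        using that boxP R by (auto simp: Q_def)
      show "pairwise (\<lambda>K L. interior K \<inter> interior L = {}) Q"
      proof (rule pairwiseI)
        fix K' L' assume "K' \<in> Q" "L' \<in> Q" "K' \<noteq> L'"
        then obtain K L where KL: "K \<in> P" "L \<in> P" "K \<noteq> L" "K' = K \<inter> H" "L' = L \<inter> H"
          by (auto simp: Q_def R_def)
        then have "interior K \<inter> interior L = {}"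
          using P by (auto simp: box_family_def pairwise_def)
        then show "interior K' \<inter> interior L' = {}"
          using KL by auto
      qed
    qed
    show "\<Union>Q \<subseteq> \<Union>P \<inter> H" by (auto simp: Q_def R_def)
    show "measure lebesgue (\<Union>Q) = measure lebesgue (\<Union>P \<inter> H)"
    proof (rule measure_negligible_symdiff[symmetric])
      show "\<Union>Q \<in> lmeasurable"
        using \<open>box_family Q\<close> compact_box_family lmeasurable_compact by blast
      have "negligible (\<Union>((\<lambda>K. K \<inter> H) ` (P - R)))"
      proof (rule negligible_Union)
        show "finite ((\<lambda>K. K \<inter> H) ` (P - R))" using fin by auto
        fix L assume "L \<in> (\<lambda>K. K \<inter> H) ` (P - R)"
        then obtain K where K: "K \<in> P" "interior (K \<inter> H) = {}" "L = K \<inter> H" by (auto simp: R_def)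
        then obtain a b where "L = cbox a b" using boxP by blast
        then show "negligible L" using K negligible_convex_interior[of L] by auto
      qed
      then show "negligible (\<Union>Q - (\<Union>P \<inter> H) \<union> (\<Union>P \<inter> H - \<Union>Q))"
        by (rule negligible_subset) (auto simp: Q_def R_def)
    qed
    show "card Q \<le> card P" using cardQ card_mono[OF fin(1) R] by simp
    show "\<forall>K\<in>P. interior (K \<inter> H) = {} \<longrightarrow> card Q < card P"
    proof (intro ballI impI)
      fix K assume "K \<in> P" "interior (K \<inter> H) = {}"
      then have "R \<subset> P" by (auto simp: R_def)
      then show "card Q < card P" using cardQ psubset_card_mono[OF fin(1) \<open>R \<subset> P\<close>] by linarith
    qed
  qed
qed

lemma box_halfspace_le:
  fixes i :: "'a::euclidean_space"
  assumes "i \<in> Basis"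
  shows "\<exists>a' b'. cbox a b \<inter> {x. x \<bullet> i \<le> c} = cbox a' b'"
  using interval_split(1)[OF assms] by blast

lemma box_halfspace_ge:
  fixes i :: "'a::euclidean_space"
  assumes "i \<in> Basis"
  shows "\<exists>a' b'. cbox a b \<inter> {x. c \<le> x \<bullet> i} = cbox a' b'"
  using interval_split(2)[OF assms] by blast

section \<open>The inequality for two boxes\<close>

text \<open>Superadditivity of the geometric mean: AM-GM is applied to the ratios
  \<open>x i / (x i + y i)\<close> and \<open>y i / (x i + y i)\<close>, whose arithmetic means add
  up to 1.\<close>

lemma prod_root_add_le:
  fixes x y :: "'a \<Rightarrow> real"
  assumes fin: "finite S" "S \<noteq> {}" and x: "\<And>i. i \<in> S \<Longrightarrow> x i > 0" and y: "\<And>i. i \<in> S \<Longrightarrow> y i > 0"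
  shows "(root (card S) (\<Prod>i\<in>S. x i) + root (card S) (\<Prod>i\<in>S. y i)) ^ card S \<le> (\<Prod>i\<in>S. x i + y i)"
proof -
  define n where "n = card S"
  have n: "n > 0" using fin by (simp add: n_def card_gt_0_iff)
  have am: "root n (\<Prod>i\<in>S. z i) \<le> (\<Sum>i\<in>S. z i / n)" if "\<And>i. i \<in> S \<Longrightarrow> z i > 0" for z
  proof -
    have "(\<Prod>i\<in>S. z i) > 0" using that by (intro prod_pos) auto
    then show ?thesis
      using arith_geom_mean[OF fin, of z] that n by (simp add: root_powr_inverse n_def less_imp_le)
  qed
  have pos: "(\<Prod>i\<in>S. x i + y i) > 0" "(\<Prod>i\<in>S. x i) > 0" "(\<Prod>i\<in>S. y i) > 0"
    using x y by (auto intro!: prod_pos add_pos_pos)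
  have s: "x i + y i > 0" if "i \<in> S" for i using x y that by (simp add: add_pos_pos)
  have "root n (\<Prod>i\<in>S. x i / (x i + y i)) + root n (\<Prod>i\<in>S. y i / (x i + y i))
      \<le> (\<Sum>i\<in>S. x i / (x i + y i) / n) + (\<Sum>i\<in>S. y i / (x i + y i) / n)"
    using x y s by (intro add_mono am) (auto intro!: divide_pos_pos)
  also have "\<dots> = (\<Sum>i\<in>S. (x i + y i) / (x i + y i) / n)"
    by (simp only: sum.distrib add_divide_distrib)
  also have "\<dots> = (\<Sum>i\<in>S. 1 / n)"
    using s by (intro sum.cong) (auto simp: less_imp_neq[symmetric])
  also have "\<dots> = 1" using n by (simp add: n_def)
  finally have "(root n (\<Prod>i\<in>S. x i) + root n (\<Prod>i\<in>S. y i)) / root n (\<Prod>i\<in>S. x i + y i) \<le> 1"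
    by (simp add: prod_dividef real_root_divide add_divide_distrib)
  then have "root n (\<Prod>i\<in>S. x i) + root n (\<Prod>i\<in>S. y i) \<le> root n (\<Prod>i\<in>S. x i + y i)"
    using pos n by (simp add: divide_le_eq)
  then have "(root n (\<Prod>i\<in>S. x i) + root n (\<Prod>i\<in>S. y i)) ^ n \<le> root n (\<Prod>i\<in>S. x i + y i) ^ n"
    using pos n by (intro power_mono add_nonneg_nonneg) (auto simp: less_imp_le)
  then show ?thesis using pos n by (simp add: n_def)
qed

text \<open>The sum contains the box whose side lengths are the sums of the given side lengths, so
  the claim reduces to products of sides.\<close>

lemma brunn_minkowski_box:
  fixes a b c d :: "'a::euclidean_space"
  assumes "box a b \<noteq> {}" "box c d \<noteq> {}"
  shows "(root DIM('a) (measure lebesgue (cbox a b)) + root DIM('a) (measure lebesgue (cbox c d))) ^ DIM('a)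
    \<le> measure lebesgue (cbox a b + cbox c d)"
proof -
  have lt: "a \<bullet> i < b \<bullet> i" "c \<bullet> i < d \<bullet> i" if "i \<in> Basis" for i
    using assms that by (auto simp: box_ne_empty)
  have sub: "cbox (a + c) (b + d) \<subseteq> cbox a b + cbox c d"
  proof
    fix z assume z: "z \<in> cbox (a + c) (b + d)"
    \<comment> \<open>The coordinatewise least point that is at least \<open>a\<close> and keeps
      \<open>z - x\<close> at most \<open>d\<close>.\<close>
    define x where "x = (\<Sum>i\<in>Basis. max (a \<bullet> i) (z \<bullet> i - d \<bullet> i) *\<^sub>R i)"
    have xi: "x \<bullet> i = max (a \<bullet> i) (z \<bullet> i - d \<bullet> i)" if "i \<in> Basis" for i
      using that by (simp add: x_def)
    have "x \<in> cbox a b" "z - x \<in> cbox c d"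
      using z lt by (force simp: mem_box xi inner_diff_left inner_add_left)+
    then show "z \<in> cbox a b + cbox c d"
      using set_plus_intro[of x _ "z - x"] by fastforce
  qed
  have "(root DIM('a) (\<Prod>i\<in>Basis. b \<bullet> i - a \<bullet> i) + root DIM('a) (\<Prod>i\<in>Basis. d \<bullet> i - c \<bullet> i)) ^ DIM('a)
     \<le> (\<Prod>i\<in>Basis. (b \<bullet> i - a \<bullet> i) + (d \<bullet> i - c \<bullet> i))"
    using lt by (intro prod_root_add_le) auto
  also have "\<dots> = measure lebesgue (cbox (a + c) (b + d))"
    using lt by (simp add: content_cbox inner_add_left add_mono less_imp_le algebra_simps)
  also have "\<dots> \<le> measure lebesgue (cbox a b + cbox c d)"
    using sub by (intro measure_mono_fmeasurable lmeasurable_compact compact_set_plus) auto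
  finally show ?thesis
    using lt by (simp add: content_cbox less_imp_le flip: inner_diff_left)
qed

section \<open>Induction over finite unions of boxes\<close>

text \<open>Boxes with disjoint interiors are separated along some axis. Which of the two lies on
  the lower side is unknown, hence the renamed \<open>K'\<close> and \<open>L'\<close>; on each side
  of the cut at least one box degenerates.\<close>

lemma box_family_separate:
  fixes K L :: "'a::euclidean_space set"
  assumes P: "box_family P" and "K \<in> P" "L \<in> P" "K \<noteq> L"
  obtains i c K' L' where "i \<in> Basis" "K' \<in> P" "L' \<in> P"
    "interior (K' \<inter> {x. c \<le> x \<bullet> i}) = {}" "interior (L' \<inter> {x. x \<bullet> i \<le> c}) = {}"
proof -
  obtain a b where K: "K = cbox a b" "interior K \<noteq> {}"
    using box_familyE[OF P \<open>K \<in> P\<close>] .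
  obtain a' b' where L: "L = cbox a' b'" "interior L \<noteq> {}"
    using box_familyE[OF P \<open>L \<in> P\<close>] .
  have "interior K \<inter> interior L = {}"
    using assms by (auto simp: box_family_def pairwise_def)
  then have "box a b \<inter> box a' b' = {}"
    using K L by simp
  then obtain i where i: "i \<in> Basis"
    "b \<bullet> i \<le> a \<bullet> i \<or> b' \<bullet> i \<le> a' \<bullet> i \<or> b \<bullet> i \<le> a' \<bullet> i \<or> b' \<bullet> i \<le> a \<bullet> i"
    unfolding disjoint_interval by blast
  \<comment> \<open>The disjointness criterion also lists degenerate boxes; positive side lengths
    exclude them.\<close>
  have "a \<bullet> i < b \<bullet> i" "a' \<bullet> i < b' \<bullet> i"
    using K L i(1) by (auto simp: box_ne_empty)
  then have disj: "b \<bullet> i \<le> a' \<bullet> i \<or> b' \<bullet> i \<le> a \<bullet> i"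
    using i by linarith
  have interior_negligible: "interior M = {}" if "negligible M" for M :: "'a set"
    using negligible_subset[OF that interior_subset] open_not_negligible[OF open_interior] by blast
  \<comment> \<open>Beyond the level of its own face a box retains only that face, which lies in a
    hyperplane.\<close>
  have thin: "interior (cbox u v \<inter> {x. v \<bullet> i \<le> x \<bullet> i}) = {}"
    "interior (cbox u v \<inter> {x. x \<bullet> i \<le> u \<bullet> i}) = {}" for u v
  proof -
    have "negligible (cbox u v \<inter> {x. v \<bullet> i \<le> x \<bullet> i})"
      by (rule negligible_subset[OF negligible_standard_hyperplane[OF i(1), of "v \<bullet> i"]])
        (auto simp: mem_box i(1) intro: antisym)
    then show "interior (cbox u v \<inter> {x. v \<bullet> i \<le> x \<bullet> i}) = {}"
      using interior_negligible by blast
  next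
    have "negligible (cbox u v \<inter> {x. x \<bullet> i \<le> u \<bullet> i})"
      by (rule negligible_subset[OF negligible_standard_hyperplane[OF i(1), of "u \<bullet> i"]])
        (auto simp: mem_box i(1) intro: antisym)
    then show "interior (cbox u v \<inter> {x. x \<bullet> i \<le> u \<bullet> i}) = {}"
      using interior_negligible by blast
  qed
  have mono: "interior (M \<inter> {x. x \<bullet> i \<le> s}) = {}"
    if "interior (M \<inter> {x. x \<bullet> i \<le> t}) = {}" "s \<le> t" for M s t
    using interior_mono[of "M \<inter> {x. x \<bullet> i \<le> s}" "M \<inter> {x. x \<bullet> i \<le> t}"] that by fastforce
  from disj show thesis
  proof
    assume "b \<bullet> i \<le> a' \<bullet> i"
    then show thesis
      using that[OF i(1) \<open>K \<in> P\<close> \<open>L \<in> P\<close>, of "b \<bullet> i"] thin mono K(1) L(1) by blast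
  next
    assume "b' \<bullet> i \<le> a \<bullet> i"
    then show thesis
      using that[OF i(1) \<open>L \<in> P\<close> \<open>K \<in> P\<close>, of "b' \<bullet> i"] thin mono K(1) L(1) by blast
  qed
qed

text \<open>Hadwiger--Ohmann induction: \<^term>\<open>P\<close> is cut by a hyperplane that separates two of its
  boxes, and \<^term>\<open>Q\<close> by a parallel hyperplane that splits its volume in the same ratio.\<close>

lemma brunn_minkowski_box_family_step:
  fixes P Q :: "'a::euclidean_space set set"
  assumes P: "box_family P" "card P > 1" and Q: "box_family Q" "Q \<noteq> {}"
    and IH: "\<And>P' Q'. \<lbrakk>box_family (P' :: 'a set set); box_family Q'; P' \<noteq> {}; Q' \<noteq> {}; card P' + card Q' < card P + card Q\<rbrakk> \<Longrightarrow>
      (root DIM('a) (measure lebesgue (\<Union>P')) + root DIM('a) (measure lebesgue (\<Union>Q'))) ^ DIM('a)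
        \<le> measure lebesgue (\<Union>P' + \<Union>Q')"
  shows "(root DIM('a) (measure lebesgue (\<Union>P)) + root DIM('a) (measure lebesgue (\<Union>Q))) ^ DIM('a)
    \<le> measure lebesgue (\<Union>P + \<Union>Q)"
proof -
  let ?m = "measure (lebesgue :: 'a measure)"
  have pos: "?m (\<Union>P) > 0" "?m (\<Union>Q) > 0"
    using P Q measure_box_family_pos[of P] measure_box_family_pos[of Q] by fastforce+
  have cpt: "compact (\<Union>P)" "compact (\<Union>Q)"
    using P Q compact_box_family by auto
  have "finite P"
    using P(1) by (simp add: box_family_def)
  then have "\<not> (\<forall>K\<in>P. \<forall>L\<in>P. K = L)"
    using P(2) card_le_Suc0_iff_eq[of P] by simp
  then obtain K0 L0 where KL0: "K0 \<in> P" "L0 \<in> P" "K0 \<noteq> L0"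
    by blast
  obtain i c K L where i: "i \<in> Basis" and KL: "K \<in> P" "L \<in> P"
    "interior (K \<inter> {x. c \<le> x \<bullet> i}) = {}" "interior (L \<inter> {x. x \<bullet> i \<le> c}) = {}"
    using box_family_separate[OF P(1) KL0] .
  have cl: "closed {x. x \<bullet> i \<le> t}" "closed {x. t \<le> x \<bullet> i}" for t
    by (auto intro!: closed_Collect_le continuous_intros)
  \<comment> \<open>The share of the volume of \<open>\<Union>P\<close> below the cut, to be matched
    by the cut of \<open>\<Union>Q\<close>.\<close>
  define \<theta> where "\<theta> = ?m (\<Union>P \<inter> {x. x \<bullet> i \<le> c}) / ?m (\<Union>P)"
  have mP: "?m (\<Union>P) = ?m (\<Union>P \<inter> {x. x \<bullet> i \<le> c}) + ?m (\<Union>P \<inter> {x. c \<le> x \<bullet> i})"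
    using measure_halfspace_split[OF lmeasurable_compact[OF cpt(1)] i] .
  have piece: "?m M > 0" "?m M = ?m (M \<inter> {x. x \<bullet> i \<le> t}) + ?m (M \<inter> {x. t \<le> x \<bullet> i})"
    "M \<in> lmeasurable" if M: "M \<in> P" for M t
  proof -
    obtain a b where M': "M = cbox a b" "interior M \<noteq> {}"
      using box_familyE[OF P(1) M] .
    show "M \<in> lmeasurable" using M' by simp
    then show "?m M > 0" "?m M = ?m (M \<inter> {x. x \<bullet> i \<le> t}) + ?m (M \<inter> {x. t \<le> x \<bullet> i})"
      using measure_pos_if_interior M'(2) measure_halfspace_split i by blast+
  qed
  have thin: "?m (M \<inter> H) = 0" if "M \<in> P" "interior (M \<inter> H) = {}" "convex H" for M H
  proof -
    obtain a b where "M = cbox a b"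
      using box_familyE[OF P(1) \<open>M \<in> P\<close>] .
    then have "convex (M \<inter> H)" using that(3) by (simp add: convex_Int)
    then show ?thesis
      using that(2) negligible_convex_interior negligible_imp_measure0 by blast
  qed
  have cvx: "convex {x. x \<bullet> i \<le> c}" "convex {x. c \<le> x \<bullet> i}"
    using convex_halfspace_le[where a = i and b = c] convex_halfspace_ge[where a = i and b = c]
    by (simp_all add: inner_commute)
  have sub: "?m (M \<inter> H) \<le> ?m (\<Union>P \<inter> H)" if "M \<in> P" "closed H" for M H
  proof (rule measure_mono_fmeasurable)
    show "M \<inter> H \<subseteq> \<Union>P \<inter> H" using that by blast
    have "H \<in> sets lebesgue" using that by simp
    then show "M \<inter> H \<in> sets lebesgue"
      using fmeasurableD[OF piece(3)[OF that(1)]] by (intro sets.Int)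
    show "\<Union>P \<inter> H \<in> lmeasurable"
      using cpt(1) that(2) by (intro lmeasurable_compact compact_Int_closed)
  qed
  \<comment> \<open>Up to a null set, \<open>K\<close> lies entirely in the lower halfspace and
    \<open>L\<close> in the upper one, so both sides have positive volume.\<close>
  have mP_pos: "?m (\<Union>P \<inter> {x. x \<bullet> i \<le> c}) > 0" "?m (\<Union>P \<inter> {x. c \<le> x \<bullet> i}) > 0"
    using piece(1)[OF KL(1)] piece(2)[OF KL(1), of c] piece(1)[OF KL(2)] piece(2)[OF KL(2), of c]
      thin[OF KL(1,3) cvx(2)] thin[OF KL(2,4) cvx(1)] sub[OF KL(1) cl(1)[of c]] sub[OF KL(2) cl(2)[of c]]
    by linarith+
  have \<theta>: "0 < \<theta>" "\<theta> < 1"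
    using mP mP_pos pos by (auto simp: \<theta>_def)
  \<comment> \<open>Intermediate value theorem between a level where the slice is empty and one
    where it is everything; the extra \<open>- 1\<close> makes the lower slice empty rather than
    merely null.\<close>
  have "\<exists>t. ?m (\<Union>Q \<inter> {x. x \<bullet> i \<le> t}) = \<theta> * ?m (\<Union>Q)"
  proof -
    obtain r where r: "\<Union>Q \<subseteq> cbox (-r) r"
      using bounded_subset_cbox_symmetric compact_imp_bounded[OF cpt(2)] by blast
    have bd: "- (r \<bullet> i) \<le> x \<bullet> i" "x \<bullet> i \<le> r \<bullet> i" if "x \<in> \<Union>Q" for x
      using r that i by (force simp: mem_box)+
    have "\<Union>Q \<inter> {x. x \<bullet> i \<le> - (r \<bullet> i) - 1} = {}"
      using bd by fastforce
    then have lo: "?m (\<Union>Q \<inter> {x. x \<bullet> i \<le> - (r \<bullet> i) - 1}) = 0"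
      by simp
    have "\<Union>Q \<inter> {x. x \<bullet> i \<le> r \<bullet> i} = \<Union>Q"
      using bd by blast
    then have hi: "?m (\<Union>Q \<inter> {x. x \<bullet> i \<le> r \<bullet> i}) = ?m (\<Union>Q)"
      by simp
    have "\<Union>Q \<noteq> {}"
      using pos(2) by (intro notI) (simp only: measure_empty)
    then obtain x where "x \<in> \<Union>Q" by blast
    then have "- (r \<bullet> i) - 1 \<le> r \<bullet> i"
      using bd[of x] by linarith
    moreover have "0 \<le> \<theta> * ?m (\<Union>Q)" "\<theta> * ?m (\<Union>Q) \<le> ?m (\<Union>Q)"
      using \<theta> pos(2) by (simp_all add: mult_left_le_one_le)
    moreover have "continuous_on {- (r \<bullet> i) - 1..r \<bullet> i} (\<lambda>t. ?m (\<Union>Q \<inter> {x. x \<bullet> i \<le> t}))"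
      by (rule continuous_on_subset[OF continuous_on_measure_halfspace[OF cpt(2) i] subset_UNIV])
    ultimately have "\<exists>t\<ge>- (r \<bullet> i) - 1. t \<le> r \<bullet> i \<and> ?m (\<Union>Q \<inter> {x. x \<bullet> i \<le> t}) = \<theta> * ?m (\<Union>Q)"
      by (intro IVT') (simp_all only: lo hi)
    then show ?thesis by blast
  qed
  then obtain t where t: "?m (\<Union>Q \<inter> {x. x \<bullet> i \<le> t}) = \<theta> * ?m (\<Union>Q)" ..
  have mQ: "?m (\<Union>Q \<inter> {x. t \<le> x \<bullet> i}) = (1 - \<theta>) * ?m (\<Union>Q)"
    using measure_halfspace_split[OF lmeasurable_compact[OF cpt(2)] i, of t] t by (simp add: algebra_simps)
  have mP1: "?m (\<Union>P \<inter> {x. x \<bullet> i \<le> c}) = \<theta> * ?m (\<Union>P)"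
    using pos by (simp add: \<theta>_def)
  have mP2: "?m (\<Union>P \<inter> {x. c \<le> x \<bullet> i}) = (1 - \<theta>) * ?m (\<Union>P)"
    using mP mP1 by (simp add: algebra_simps)
  let ?d = "DIM('a)"
  let ?s = "root ?d (?m (\<Union>P)) + root ?d (?m (\<Union>Q))"
  \<comment> \<open>One statement for both sides of the cut. Scaling both volumes by \<eta> scales
    the \<open>d\<close>-th power of the sum of their roots by \<eta>; the box \<open>M\<close>,
    lost in the cut, makes the total number of boxes drop.\<close>
  have half: "\<eta> * ?s ^ ?d \<le> ?m ((\<Union>P + \<Union>Q) \<inter> J)"
    if J_closed: "closed J" and box: "\<And>a b. \<exists>a' b'. cbox a b \<inter> H = cbox a' b'"
      "\<And>a b. \<exists>a' b'. cbox a b \<inter> H' = cbox a' b'" and \<eta>: "\<eta> > 0"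
      and m: "?m (\<Union>P \<inter> H) = \<eta> * ?m (\<Union>P)" "?m (\<Union>Q \<inter> H') = \<eta> * ?m (\<Union>Q)"
      and M: "M \<in> P" "interior (M \<inter> H) = {}" and J: "H + H' \<subseteq> J" for H H' J M \<eta>
  proof -
    obtain P' where P': "box_family P'" "\<Union>P' \<subseteq> \<Union>P \<inter> H" "?m (\<Union>P') = ?m (\<Union>P \<inter> H)"
      "\<forall>K\<in>P. interior (K \<inter> H) = {} \<longrightarrow> card P' < card P" "card P' \<le> card P"
      using box_family_cut[OF P(1) box(1)] .
    obtain Q' where Q': "box_family Q'" "\<Union>Q' \<subseteq> \<Union>Q \<inter> H'" "?m (\<Union>Q') = ?m (\<Union>Q \<inter> H')"
      "\<forall>K\<in>Q. interior (K \<inter> H') = {} \<longrightarrow> card Q' < card Q" "card Q' \<le> card Q"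
      using box_family_cut[OF Q(1) box(2)] .
    have mPQ: "?m (\<Union>P') = \<eta> * ?m (\<Union>P)" "?m (\<Union>Q') = \<eta> * ?m (\<Union>Q)"
      using P'(3) Q'(3) m by simp_all
    then have mPQ_pos: "?m (\<Union>P') > 0" "?m (\<Union>Q') > 0"
      using pos \<eta> by simp_all
    have card: "card P' + card Q' < card P + card Q"
      using bspec[OF P'(4) M(1)] M(2) Q'(5) by linarith
    have "P' \<noteq> {}" "Q' \<noteq> {}"
      using mPQ_pos by (auto simp only: Union_empty measure_empty less_irrefl)
    have "\<eta> * ?s ^ ?d = (root ?d \<eta> * ?s) ^ ?d"
      using \<eta> by (simp add: power_mult_distrib)
    also have "\<dots> = (root ?d (?m (\<Union>P')) + root ?d (?m (\<Union>Q'))) ^ ?d"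
      by (simp add: mPQ real_root_mult distrib_left)
    also have "\<dots> \<le> ?m (\<Union>P' + \<Union>Q')"
      by (rule IH[OF P'(1) Q'(1) \<open>P' \<noteq> {}\<close> \<open>Q' \<noteq> {}\<close> card])
    also have "\<dots> \<le> ?m ((\<Union>P + \<Union>Q) \<inter> J)"
    proof (rule measure_mono_fmeasurable)
      have "\<Union>P' + \<Union>Q' \<subseteq> \<Union>P + \<Union>Q" "\<Union>P' + \<Union>Q' \<subseteq> H + H'"
        using P'(2) Q'(2) by (intro set_plus_mono2; blast)+
      then show "\<Union>P' + \<Union>Q' \<subseteq> (\<Union>P + \<Union>Q) \<inter> J"
        using J by blast
      show "\<Union>P' + \<Union>Q' \<in> sets lebesgue"
        by (intro fmeasurableD lmeasurable_compact compact_set_plus compact_box_family P'(1) Q'(1))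
      show "(\<Union>P + \<Union>Q) \<inter> J \<in> lmeasurable"
        by (intro lmeasurable_compact compact_Int_closed compact_set_plus cpt J_closed)
    qed
    finally show ?thesis .
  qed
  \<comment> \<open>The sums of the lower and of the upper pieces lie on opposite sides of the level
    \<open>c + t\<close>, so the shares \<theta> and \<open>1 - \<theta>\<close> add up.\<close>
  have "{x. x \<bullet> i \<le> c} + {x. x \<bullet> i \<le> t} \<subseteq> {x. x \<bullet> i \<le> c + t}"
    "{x. c \<le> x \<bullet> i} + {x. t \<le> x \<bullet> i} \<subseteq> {x. c + t \<le> x \<bullet> i}"
    by (auto simp: set_plus_def inner_add_left)
  then have "\<theta> * ?s ^ ?d \<le> ?m ((\<Union>P + \<Union>Q) \<inter> {x. x \<bullet> i \<le> c + t})"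
    "(1 - \<theta>) * ?s ^ ?d \<le> ?m ((\<Union>P + \<Union>Q) \<inter> {x. c + t \<le> x \<bullet> i})"
    using \<theta> half[OF cl(1) box_halfspace_le[OF i] box_halfspace_le[OF i] _ mP1 t KL(2,4)]
      half[OF cl(2) box_halfspace_ge[OF i] box_halfspace_ge[OF i] _ mP2 mQ KL(1,3)]
    by simp_all
  then show ?thesis
    using measure_halfspace_split[OF lmeasurable_compact[OF compact_set_plus[OF cpt]] i, of "c + t"]
    by (simp add: algebra_simps)
qed

text \<open>Strong induction on the total number of boxes. The step cuts its first family, so if
  only \<open>Q\<close> has several boxes the roles are exchanged by commutativity.\<close>

lemma brunn_minkowski_box_family:
  fixes P Q :: "'a::euclidean_space set set"
  assumes "box_family P" "P \<noteq> {}" "box_family Q" "Q \<noteq> {}"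
  shows "(root DIM('a) (measure lebesgue (\<Union>P)) + root DIM('a) (measure lebesgue (\<Union>Q))) ^ DIM('a)
    \<le> measure lebesgue (\<Union>P + \<Union>Q)"
  using assms
proof (induction "card P + card Q" arbitrary: P Q rule: less_induct)
  case less
  have fin: "finite P" "finite Q"
    using less.prems by (auto simp: box_family_def)
  consider "card P > 1" | "card Q > 1" | "card P = 1" "card Q = 1"
  proof -
    have "card P > 0" "card Q > 0"
      using less.prems fin by (simp_all add: card_gt_0_iff)
    then show thesis
      using that by linarith
  qed
  then show ?case
  proof cases
    case 1
    then show ?thesis
      by (rule brunn_minkowski_box_family_step[OF less.prems(1) _ less.prems(3,4) less.hyps])
  next
    case 2
    then have "(root DIM('a) (measure lebesgue (\<Union>Q)) + root DIM('a) (measure lebesgue (\<Union>P))) ^ DIM('a)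
        \<le> measure lebesgue (\<Union>Q + \<Union>P)"
      by (rule brunn_minkowski_box_family_step[OF less.prems(3) _ less.prems(1,2) less.hyps])
        (simp_all add: add.commute)
    then show ?thesis by (simp add: add.commute)
  next
    case 3
    then obtain K L where KL: "P = {K}" "Q = {L}"
      using card_1_singletonE by metis
    obtain a b where K: "K = cbox a b" "interior K \<noteq> {}"
      using box_familyE[of P K] less.prems KL by blast
    obtain a' b' where L: "L = cbox a' b'" "interior L \<noteq> {}"
      using box_familyE[of Q L] less.prems KL by blast
    show ?thesis
      using brunn_minkowski_box[of a b a' b'] K L KL by simp
  qed
qed

section \<open>Passage from box families to compact sets\<close>

text \<open>The family consists of the nondegenerate pieces of a fine division that meet
  \<open>A\<close>. Dropping degenerate pieces may uncover a null part of \<open>A\<close>, so only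
  the volumes are compared.\<close>

lemma box_family_cover:
  fixes A :: "'a::euclidean_space set"
  assumes "compact A" "e > 0"
  obtains P where "box_family P" "measure lebesgue A \<le> measure lebesgue (\<Union>P)"
    "\<And>x. x \<in> \<Union>P \<Longrightarrow> \<exists>y\<in>A. dist x y < e"
proof -
  obtain r where r: "A \<subseteq> cbox (-r) r"
    using bounded_subset_cbox_symmetric compact_imp_bounded[OF assms(1)] by blast
  \<comment> \<open>Radius \<open>e / 2\<close> about the tag puts any two points of a piece at
    distance below \<open>e\<close>.\<close>
  have "gauge (\<lambda>x::'a. ball x (e / 2))"
    using assms(2) by (simp add: gauge_def)
  then obtain p where p: "p tagged_division_of cbox (-r) r" "(\<lambda>x. ball x (e / 2)) fine p"
    using fine_division_exists by blast
  define P where "P = {K \<in> snd ` p. K \<inter> A \<noteq> {} \<and> interior K \<noteq> {}}"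
  define N where "N = {K \<in> snd ` p. interior K = {}}"
  have fin: "finite (snd ` p)"
    using p(1) by blast
  have box: "\<exists>a b. K = cbox a b" if "K \<in> snd ` p" for K
    using that tagged_division_ofD(4)[OF p(1)] by force
  show thesis
  proof (rule that)
    show fam: "box_family P"
      unfolding box_family_def
    proof (intro conjI ballI)
      show "finite P" using fin by (simp add: P_def)
      show "interior K \<noteq> {}" "\<exists>a b. K = cbox a b" if "K \<in> P" for K
        using that box by (simp_all add: P_def)
      show "pairwise (\<lambda>K L. interior K \<inter> interior L = {}) P"
      proof (rule pairwiseI)
        fix K L assume "K \<in> P" "L \<in> P" "K \<noteq> L"
        then show "interior K \<inter> interior L = {}"
          using tagged_division_ofD(5)[OF p(1)] unfolding P_def by fastforce
      qed
    qed
    have N: "negligible (\<Union>N)"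
    proof (rule negligible_Union)
      show "finite N" using fin by (simp add: N_def)
      show "negligible K" if K: "K \<in> N" for K
      proof -
        obtain a b where "K = cbox a b" using box[of K] K by (auto simp: N_def)
        then show ?thesis using K negligible_convex_interior[of K] by (simp add: N_def)
      qed
    qed
    have sub: "A \<subseteq> \<Union>P \<union> \<Union>N"
    proof
      fix x assume x: "x \<in> A"
      then have "x \<in> \<Union>{K. \<exists>y. (y, K) \<in> p}"
        using r tagged_division_ofD(6)[OF p(1)] by blast
      then obtain y K where K: "(y, K) \<in> p" "x \<in> K"
        by blast
      then have "K \<in> snd ` p" by force
      then show "x \<in> \<Union>P \<union> \<Union>N"
        using x K(2) by (cases "interior K = {}") (auto simp: P_def N_def)
    qed
    have mP: "\<Union>P \<in> lmeasurable" "\<Union>N \<in> lmeasurable"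
      using lmeasurable_compact[OF compact_box_family[OF fam]] N
      by (simp_all only: negligible_iff_measure)
    have "measure lebesgue A \<le> measure lebesgue (\<Union>P \<union> \<Union>N)"
      by (rule measure_mono_fmeasurable[OF sub fmeasurableD[OF lmeasurable_compact[OF assms(1)]]
          fmeasurable.Un[OF mP]])
    also have "\<dots> \<le> measure lebesgue (\<Union>P) + measure lebesgue (\<Union>N)"
      by (rule measure_Un_le[OF fmeasurableD[OF mP(1)] fmeasurableD[OF mP(2)]])
    finally show "measure lebesgue A \<le> measure lebesgue (\<Union>P)"
      by (simp add: negligible_imp_measure0[OF N])
    show "\<exists>y\<in>A. dist x y < e" if x: "x \<in> \<Union>P" for x
    proof -
      from x obtain K where K: "K \<in> P" "x \<in> K" by blast
      then have "K \<in> snd ` p" "K \<inter> A \<noteq> {}"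
        by (simp_all add: P_def)
      then obtain z y where "(z, K) \<in> p" "y \<in> K" "y \<in> A"
        by force
      then have "x \<in> ball z (e / 2)" "y \<in> ball z (e / 2)"
        using fineD[OF p(2)] K(2) by blast+
      then have "dist x y < e"
        using dist_triangle_half_r[of z x e y] by simp
      then show ?thesis using \<open>y \<in> A\<close> by blast
    qed
  qed
qed

text \<open>An open set \<open>U\<close> with at most \<open>e\<close> more volume than
  \<open>A + B\<close> contains a neighbourhood of \<open>A + B\<close> of some radius \<epsilon>.
  Box families within \<open>\<epsilon> / 2\<close> of \<open>A\<close> and of \<open>B\<close> have
  their sum inside \<open>U\<close>, so the box case carries over up to \<open>e\<close>.\<close>

theorem brunn_minkowski:
  fixes A B :: "'a::euclidean_space set"
  assumes A: "compact A" "A \<noteq> {}" and B: "compact B" "B \<noteq> {}"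
  shows "root DIM('a) (measure lebesgue A) + root DIM('a) (measure lebesgue B)
    \<le> root DIM('a) (measure lebesgue (A + B))"
proof -
  let ?m = "measure (lebesgue :: 'a measure)" and ?d = "DIM('a)"
  have AB: "compact (A + B)" using A B compact_set_plus by blast
  have translate: "?m T \<le> ?m (S + T)" if ST: "compact S" "compact T" "S \<noteq> {}" for S T :: "'a set"
  proof -
    obtain a where "a \<in> S" using ST(3) by blast
    then have "(+) a ` T \<subseteq> S + T" by (auto simp: set_plus_def)
    then have "?m ((+) a ` T) \<le> ?m (S + T)"
      by (rule measure_mono_fmeasurable)
        (intro fmeasurableD lmeasurable_compact compact_set_plus compact_translation ST)+
    then show ?thesis by (simp add: measure_translation)
  qed
  \<comment> \<open>A null set could be matched by the empty family, for which the box case says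
    nothing; there \<open>A + B\<close> contains a translate of the other set.\<close>
  consider "?m A = 0" | "?m B = 0" | "?m A > 0" "?m B > 0"
    using measure_nonneg[of lebesgue A] measure_nonneg[of lebesgue B] by linarith
  then show ?thesis
  proof cases
    case 1
    then show ?thesis using translate[OF A(1) B(1) A(2)] by simp
  next
    case 2
    then show ?thesis using translate[OF B(1) A(1) B(2)] by (simp add: add.commute)
  next
    case 3
    have "(root ?d (?m A) + root ?d (?m B)) ^ ?d \<le> ?m (A + B) + e" if e: "e > 0" for e
    proof -
      obtain U where U: "open U" "A + B \<subseteq> U" "U - (A + B) \<in> lmeasurable"
        "emeasure lebesgue (U - (A + B)) < ennreal e"
        using sets_lebesgue_outer_open[OF fmeasurableD[OF lmeasurable_compact[OF AB]] e] .
      obtain \<epsilon> where \<epsilon>: "\<epsilon> > 0" "(\<Union>x\<in>A + B. ball x \<epsilon>) \<subseteq> U"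
        using compact_subset_open_imp_ball_epsilon_subset[OF AB U(1,2)] .
      have "\<epsilon> / 2 > 0" using \<epsilon>(1) by simp
      obtain P where P: "box_family P" "?m A \<le> ?m (\<Union>P)" "\<And>x. x \<in> \<Union>P \<Longrightarrow> \<exists>y\<in>A. dist x y < \<epsilon> / 2"
        using box_family_cover[OF A(1) \<open>\<epsilon> / 2 > 0\<close>] by blast
      obtain Q where Q: "box_family Q" "?m B \<le> ?m (\<Union>Q)" "\<And>x. x \<in> \<Union>Q \<Longrightarrow> \<exists>y\<in>B. dist x y < \<epsilon> / 2"
        using box_family_cover[OF B(1) \<open>\<epsilon> / 2 > 0\<close>] by blast
      have ne: "P \<noteq> {}" "Q \<noteq> {}" using 3 P(2) Q(2) by fastforce+
      have sub: "\<Union>P + \<Union>Q \<subseteq> U"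
      proof
        fix z assume "z \<in> \<Union>P + \<Union>Q"
        then obtain x y where xy: "z = x + y" "x \<in> \<Union>P" "y \<in> \<Union>Q"
          by (rule set_plus_elim)
        obtain x' y' where *: "x' \<in> A" "dist x x' < \<epsilon> / 2" "y' \<in> B" "dist y y' < \<epsilon> / 2"
          using P(3)[OF xy(2)] Q(3)[OF xy(3)] by blast
        have "dist (x' + y') z \<le> dist x x' + dist y y'"
          using dist_triangle_add[of x y x' y'] by (simp add: xy(1) dist_commute)
        then have "z \<in> ball (x' + y') \<epsilon>" using * by simp
        moreover have "x' + y' \<in> A + B" using * by blast
        ultimately show "z \<in> U" using \<epsilon>(2) by blast
      qed
      have UAB: "U = (A + B) \<union> (U - (A + B))" using U(2) by blast
      have mAB: "A + B \<in> lmeasurable" using AB lmeasurable_compact by blast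
      then have Um: "U \<in> lmeasurable" using UAB U(3) fmeasurable.Un by metis
      have "?m (U - (A + B)) < e"
        using U(3,4) e by (simp add: emeasure_eq_measure2 ennreal_less_iff)
      moreover have "?m U = ?m (A + B) + ?m (U - (A + B))"
        using measure_Un2[OF mAB Um] U(2) by (simp add: Un_absorb1)
      ultimately have mU: "?m U \<le> ?m (A + B) + e" by linarith
      have "(root ?d (?m A) + root ?d (?m B)) ^ ?d \<le> (root ?d (?m (\<Union>P)) + root ?d (?m (\<Union>Q))) ^ ?d"
        using P(2) Q(2) by (intro power_mono add_mono add_nonneg_nonneg) auto
      also have "\<dots> \<le> ?m (\<Union>P + \<Union>Q)"
        by (rule brunn_minkowski_box_family[OF P(1) ne(1) Q(1) ne(2)])
      also have "\<dots> \<le> ?m U"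
        by (rule measure_mono_fmeasurable[OF sub _ Um])
          (intro fmeasurableD lmeasurable_compact compact_set_plus compact_box_family P(1) Q(1))
      finally show ?thesis using mU by linarith
    qed
    then have "(root ?d (?m A) + root ?d (?m B)) ^ ?d \<le> ?m (A + B)"
      by (rule field_le_epsilon)
    then have "root ?d ((root ?d (?m A) + root ?d (?m B)) ^ ?d) \<le> root ?d (?m (A + B))"
      by simp
    then show ?thesis by (subst (asm) real_root_power_cancel) auto
  qed
qed

section \<open>Subdifferentials of nodal functions\<close>

text \<open>The constraints at the nodes extend to the convex hull, hence to a ball around
  \<open>x\<close>; testing at the point of that ball in direction \<open>p\<close> bounds the norm
  of \<open>p\<close>.\<close>

lemma bounded_slopes:
  fixes x :: "'a::euclidean_space"
  assumes "finite N" "x \<in> interior (convex hull N)"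
  shows "bounded {p. \<forall>y\<in>N. p \<bullet> (y - x) \<le> f y}"
proof -
  obtain r where r: "r > 0" "cball x r \<subseteq> convex hull N"
    using assms(2) mem_interior_cball by blast
  \<comment> \<open>Inserting 0 keeps the bound \<open>M / r\<close> nonnegative, as the case
    \<open>p = 0\<close> requires.\<close>
  define M where "M = Max (insert 0 (f ` N))"
  have M: "0 \<le> M" "\<And>y. y \<in> N \<Longrightarrow> f y \<le> M"
    using assms(1) by (auto simp: M_def)
  show ?thesis
  proof (rule boundedI)
    fix p assume "p \<in> {p. \<forall>y\<in>N. p \<bullet> (y - x) \<le> f y}"
    then have "N \<subseteq> {z. p \<bullet> z \<le> M + p \<bullet> x}"
      using M(2) by (fastforce simp: inner_diff_right)
    then have hull: "convex hull N \<subseteq> {z. p \<bullet> z \<le> M + p \<bullet> x}"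
      by (rule hull_minimal) (rule convex_halfspace_le)
    show "norm p \<le> M / r"
    proof (cases "p = 0")
      case False
      have "x + (r / norm p) *\<^sub>R p \<in> cball x r"
        using False r(1) by (simp add: dist_norm)
      then have "p \<bullet> (x + (r / norm p) *\<^sub>R p) \<le> M + p \<bullet> x"
        using hull r(2) by blast
      then have "r / norm p * (norm p)\<^sup>2 \<le> M"
        by (simp add: inner_add_right power2_norm_eq_inner)
      then show ?thesis
        using False r(1) by (simp add: field_simps power2_eq_square)
    qed (use M(1) r(1) in simp)
  qed
qed

text \<open>The right-hand side \<open>f\<close> is arbitrary in order to cover both exact
  subdifferentials and approximate ones with slack.\<close>

lemma compact_slopes:
  fixes x :: "'a::euclidean_space"
  assumes "finite N" "x \<in> interior (convex hull N)"
  shows "compact {p. \<forall>y\<in>N. p \<bullet> (y - x) \<le> f y}"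
proof -
  have "{p. \<forall>y\<in>N. p \<bullet> (y - x) \<le> f y} = (\<Inter>y\<in>N. {p. p \<bullet> (y - x) \<le> f y})"
    by auto
  moreover have "closed \<dots>"
    by (intro closed_INT ballI closed_Collect_le continuous_intros)
  ultimately have "closed {p. \<forall>y\<in>N. p \<bullet> (y - x) \<le> f y}"
    by (simp only:)
  then show ?thesis
    using bounded_slopes[OF assms] compact_eq_bounded_closed by blast
qed

lemma subdifferential_eq_slopes:
  "subdifferential N v x = {p. \<forall>y\<in>N. p \<bullet> (y - x) \<le> v y - v x}"
  by (auto simp: subdifferential_def algebra_simps)

lemma compact_subdifferential:
  assumes "finite N" "x \<in> interior (convex hull N)"
  shows "compact (subdifferential N v x)"
  unfolding subdifferential_eq_slopes by (rule compact_slopes[OF assms])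

text \<open>The supremum in the envelope is a limit of minorants only; compactness of the sets of
  approximate slopes makes it attained.\<close>

lemma subdifferential_nonempty:
  assumes N: "finite N" "x \<in> N" "x \<in> interior (convex hull N)"
    and env: "convex_envelope N v x = v x"
  shows "subdifferential N v x \<noteq> {}"
proof -
  define S where "S = {p \<bullet> x + c | p c. \<forall>y\<in>N. p \<bullet> y + c \<le> v y}"
  \<comment> \<open>Subgradients up to a slack: the slope of any minorant whose value at
    \<open>x\<close> is within the slack of \<open>v x\<close> belongs to
    \<open>F n\<close>.\<close>
  define F where "F n = {p. \<forall>y\<in>N. p \<bullet> (y - x) \<le> v y - v x + inverse (real (Suc n))}" for n
  \<comment> \<open>The constant minorant shows that the supremum is over a nonempty set.\<close>
  have "0 \<bullet> x + Min (v ` N) \<in> S"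
    unfolding S_def using N by (intro CollectI exI[of _ 0] exI[of _ "Min (v ` N)"]) auto
  then have S: "S \<noteq> {}" "Sup S = v x"
    using env by (auto simp: convex_envelope_def S_def)
  have "\<Inter>(range F) \<noteq> {}"
  proof (rule compact_nest)
    show "compact (F n)" for n
      unfolding F_def by (rule compact_slopes[OF N(1,3)])
    show "F n \<noteq> {}" for n
    proof -
      have "v x - inverse (real (Suc n)) < Sup S" using S by simp
      then obtain s where "s \<in> S" "v x - inverse (real (Suc n)) < s"
        using S(1) less_cSupD by blast
      then obtain p c where pc: "v x - inverse (real (Suc n)) < p \<bullet> x + c" "\<forall>y\<in>N. p \<bullet> y + c \<le> v y"
        by (auto simp: S_def)
      then have "p \<in> F n"
        unfolding F_def by (fastforce simp: inner_diff_right)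
      then show ?thesis by blast
    qed
    show "F n \<subseteq> F m" if "m \<le> n" for m n
    proof -
      have "inverse (real (Suc n)) \<le> inverse (real (Suc m))"
        using that by (intro le_imp_inverse_le) auto
      then have "t \<le> s + inverse (real (Suc m))" if "t \<le> s + inverse (real (Suc n))" for s t :: real
        using that by linarith
      then show ?thesis unfolding F_def by blast
    qed
  qed
  then obtain p where p: "\<And>n. p \<in> F n" by blast
  have "p \<bullet> (y - x) \<le> v y - v x" if "y \<in> N" for y
  proof (rule field_le_epsilon)
    fix e :: real assume "e > 0"
    then obtain n where "inverse (real (Suc n)) < e"
      using reals_Archimedean by blast
    then show "p \<bullet> (y - x) \<le> v y - v x + e"
      using p[of n] that unfolding F_def by fastforce
  qed
  then show ?thesis unfolding subdifferential_eq_slopes by blast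
qed

section \<open>Brunn--Minkowski at a contact node\<close>

text \<open>Adding the subgradient inequalities of \<open>v - w\<close> and \<open>w\<close> gives
  one for \<open>v\<close>. Brunn--Minkowski asks for nonempty compact sets: contact supplies
  nonemptiness for \<open>v - w\<close>, the last hypothesis for \<open>w\<close>, and the position
  of \<open>x\<close> in the hull supplies compactness.\<close>

lemma root_measure_subdifferential_diff:
  fixes x :: "real ^ 'n"
  assumes N: "finite N" "x \<in> N" "x \<in> interior (convex hull N)"
    and env: "convex_envelope N (\<lambda>y. v y - w y) x = v x - w x" and w: "subdifferential N w x \<noteq> {}"
  shows "root CARD('n) (measure lebesgue (subdifferential N (\<lambda>y. v y - w y) x))
      + root CARD('n) (measure lebesgue (subdifferential N w x))
    \<le> root CARD('n) (measure lebesgue (subdifferential N v x))"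
proof -
  let ?U = "subdifferential N (\<lambda>y. v y - w y) x" and ?W = "subdifferential N w x"
  let ?V = "subdifferential N v x"
  note cpt = compact_subdifferential[OF N(1,3)]
  have sub: "?U + ?W \<subseteq> ?V"
  proof
    fix r assume "r \<in> ?U + ?W"
    then obtain p q where "r = p + q" "p \<in> ?U" "q \<in> ?W"
      by (rule set_plus_elim)
    then show "r \<in> ?V"
      unfolding subdifferential_eq_slopes by (fastforce simp: inner_add_left)
  qed
  have "root DIM(real ^ 'n) (measure lebesgue ?U) + root DIM(real ^ 'n) (measure lebesgue ?W)
      \<le> root DIM(real ^ 'n) (measure lebesgue (?U + ?W))"
    by (rule brunn_minkowski[OF cpt subdifferential_nonempty[OF N env] cpt w])
  also have "measure lebesgue (?U + ?W) \<le> measure lebesgue ?V"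
    by (rule measure_mono_fmeasurable[OF sub fmeasurableD[OF lmeasurable_compact[OF compact_set_plus[OF cpt cpt]]]
          lmeasurable_compact[OF cpt]])
  then have "root DIM(real ^ 'n) (measure lebesgue (?U + ?W)) \<le> root DIM(real ^ 'n) (measure lebesgue ?V)"
    by simp
  finally show ?thesis by simp
qed

section \<open>Contact nodes and the ball of slopes that they cover\<close>

text \<open>The affine function of slope \<open>p\<close> through the graph at \<open>x\<close> is
  itself a minorant, and no minorant exceeds \<open>u x\<close> at the node
  \<open>x\<close>.\<close>

lemma convex_envelope_eq_if_subgradient:
  assumes "x \<in> N" "p \<in> subdifferential N u x"
  shows "convex_envelope N u x = u x"
  unfolding convex_envelope_def
proof (rule cSup_eq_maximum)
  have "u x = p \<bullet> x + (u x - p \<bullet> x) \<and> (\<forall>y\<in>N. p \<bullet> y + (u x - p \<bullet> x) \<le> u y)"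
    using assms(2) by (auto simp: subdifferential_def inner_diff_right algebra_simps)
  then show "u x \<in> {p \<bullet> x + c | p c. \<forall>y\<in>N. p \<bullet> y + c \<le> u y}"
    by blast
  show "s \<le> u x" if "s \<in> {p \<bullet> x + c | p c. \<forall>y\<in>N. p \<bullet> y + c \<le> u y}" for s
    using that assms(1) by auto
qed

lemma ball_subset_contact_subdifferentials:
  fixes u :: "real ^ 'n \<Rightarrow> real"
  assumes fin: "finite (N0 \<union> Nb)" and x0: "x0 \<in> N0 \<union> Nb" and m: "u x0 < 0" and D: "D > 0"
    and dist: "\<And>y. y \<in> N0 \<union> Nb \<Longrightarrow> dist y x0 \<le> D" and bd: "\<And>y. y \<in> Nb \<Longrightarrow> u y \<ge> 0"
  shows "ball 0 (- u x0 / D) \<subseteq> (\<Union>x\<in>contact_set N0 Nb u. subdifferential (N0 \<union> Nb) u x)"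
proof
  let ?N = "N0 \<union> Nb"
  fix p :: "real ^ 'n" assume "p \<in> ball 0 (- u x0 / D)"
  then have p: "norm p * D < - u x0"
    using D by (simp add: field_simps)
  obtain x where x: "x \<in> ?N" "\<And>y. y \<in> ?N \<Longrightarrow> u x - p \<bullet> x \<le> u y - p \<bullet> y"
  proof -
    have "?N \<noteq> {}" using x0 by blast
    then obtain x where "is_arg_min (\<lambda>y. u y - p \<bullet> y) (\<lambda>y. y \<in> ?N) x"
      using ex_is_arg_min_if_finite[OF fin] by blast
    then show thesis
      using that by (auto simp: is_arg_min_linorder)
  qed
  have sub: "p \<in> subdifferential ?N u x"
    using x(2) by (auto simp: subdifferential_def inner_diff_right algebra_simps)
  \<comment> \<open>At a boundary minimizer \<open>u x\<close> is nonnegative, so comparison with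
    \<open>x0\<close> would force \<open>- u x0\<close> to be at most
    \<open>norm p * D\<close>.\<close>
  have "x \<notin> Nb"
  proof
    assume "x \<in> Nb"
    then have "- u x0 \<le> p \<bullet> (x - x0)"
      using bd[of x] x(2)[OF x0] by (simp add: inner_diff_right)
    also have "\<dots> \<le> norm p * norm (x - x0)"
      by (rule norm_cauchy_schwarz)
    also have "\<dots> \<le> norm p * D"
      using dist[OF x(1)] by (intro mult_left_mono) (simp_all add: dist_norm)
    finally show False using p by simp
  qed
  then show "p \<in> (\<Union>x\<in>contact_set N0 Nb u. subdifferential ?N u x)"
    using x(1) sub convex_envelope_eq_if_subgradient[OF x(1) sub] by (auto simp: contact_set_def)
qed

section \<open>Nodes of the mesh and the final estimate\<close>

text \<open>Each simplex is the hull of its vertices, so the meshed region lies in the hull of the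
  nodes. Interior nodes are then interior to that hull, which is what makes their subdifferentials
  compact.\<close>

lemma nodal_mesh_nodes:
  fixes \<Omega> :: "(real ^ 'n) set"
  assumes mesh: "nodal_mesh \<Omega> \<T> N0 Nb"
  shows "finite (N0 \<union> Nb)" "N0 \<union> Nb \<noteq> {}" "N0 \<union> Nb \<subseteq> closure \<Omega>" "N0 \<subseteq> interior (convex hull (N0 \<union> Nb))"
proof -
  have tri: "finite \<T>" "\<T> \<noteq> {}" "\<And>T. T \<in> \<T> \<Longrightarrow> int CARD('n) simplex T"
    and N: "N0 \<union> Nb = (\<Union>T\<in>\<T>. {x. x extreme_point_of T})"
    and N0: "N0 \<subseteq> interior (\<Union>\<T>)" "\<Union>\<T> \<subseteq> closure \<Omega>"
    using mesh by (auto simp: nodal_mesh_def triangulation_def)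
  have T: "finite {x. x extreme_point_of T}" "T = convex hull {x. x extreme_point_of T}" "T \<noteq> {}"
    if T: "T \<in> \<T>" for T
  proof -
    obtain C where C: "finite C" "T = convex hull C"
      using tri(3)[OF T] unfolding simplex by blast
    show "finite {x. x extreme_point_of T}"
      using C extreme_points_of_convex_hull finite_subset by metis
    show "T = convex hull {x. x extreme_point_of T}"
      using C by (intro Krein_Milman_Minkowski) (simp_all add: finite_imp_compact_convex_hull)
    \<comment> \<open>The empty set has affine dimension -1, which the dimension of \<open>T\<close>
      rules out.\<close>
    show "T \<noteq> {}"
      using aff_dim_simplex[OF tri(3)[OF T]] by auto
  qed
  show "finite (N0 \<union> Nb)"
    unfolding N using tri(1) T(1) by blast
  obtain T0 where T0: "T0 \<in> \<T>" using tri(2) by blast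
  then have "{x. x extreme_point_of T0} \<noteq> {}"
    using T(2,3)[OF T0] by (metis convex_hull_empty)
  then show "N0 \<union> Nb \<noteq> {}"
    unfolding N using T0 by blast
  show "N0 \<union> Nb \<subseteq> closure \<Omega>"
    unfolding N using N0(2) by (auto simp: extreme_point_of_def)
  have "\<Union>\<T> \<subseteq> convex hull (N0 \<union> Nb)"
  proof (rule Union_least)
    fix T assume "T \<in> \<T>"
    then have "convex hull {x. x extreme_point_of T} \<subseteq> convex hull (N0 \<union> Nb)"
      unfolding N by (intro hull_mono) blast
    then show "T \<subseteq> convex hull (N0 \<union> Nb)"
      using T(2)[OF \<open>T \<in> \<T>\<close>] by simp
  qed
  then show "N0 \<subseteq> interior (convex hull (N0 \<union> Nb))"
    using N0(1) interior_mono by blast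
qed

text \<open>The factor \<open>c\<close> is chosen before the domain and so depends on the dimension
  alone; the domain enters the constant only through its diameter.\<close>

theorem proposition4p3:
  assumes "CARD('n::finite) \<ge> 2"
  shows "\<exists>c>0. \<forall>(\<Omega> :: (real ^ 'n) set) \<T> N0 Nb (v :: real ^ 'n \<Rightarrow> real) w.
    uniformly_convex_domain \<Omega> \<longrightarrow>
    nodal_mesh \<Omega> \<T> N0 Nb \<longrightarrow>
    (\<forall>x\<in>Nb. v x \<ge> w x) \<longrightarrow>
    (\<forall>x\<in>contact_set N0 Nb (\<lambda>x. v x - w x). subdifferential (N0 \<union> Nb) w x \<noteq> {}) \<longrightarrow>
    (SUP x\<in>N0 \<union> Nb. neg_part (v x - w x)) \<le>
      c * diameter \<Omega> * root CARD('n)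
        (\<Sum>x\<in>contact_set N0 Nb (\<lambda>x. v x - w x).
          (root CARD('n) (measure lebesgue (subdifferential (N0 \<union> Nb) v x)) -
           root CARD('n) (measure lebesgue (subdifferential (N0 \<union> Nb) w x))) ^ CARD('n))"
proof -
  define V where "V = unit_ball_vol (real CARD('n))"
  have V: "V > 0" by (simp add: V_def)
  show ?thesis
  \<comment> \<open>With \<open>m\<close> the negative part at a node and \<open>D\<close> the
    diameter, volumes give \<open>V * (m / D) ^ d \<le> S\<close>; solving for \<open>m\<close>
    yields this factor.\<close>
  proof (intro exI[of _ "1 / root CARD('n) V"] conjI allI impI)
    show "1 / root CARD('n) V > 0" using V by simp
    fix \<Omega> :: "(real ^ 'n) set" and \<T> N0 Nb and v w :: "real ^ 'n \<Rightarrow> real"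
    assume \<Omega>: "uniformly_convex_domain \<Omega>" and mesh: "nodal_mesh \<Omega> \<T> N0 Nb"
      and bd: "\<forall>x\<in>Nb. v x \<ge> w x"
      and w: "\<forall>x\<in>contact_set N0 Nb (\<lambda>x. v x - w x). subdifferential (N0 \<union> Nb) w x \<noteq> {}"
    let ?N = "N0 \<union> Nb" and ?u = "\<lambda>x. v x - w x" and ?D = "diameter \<Omega>" and ?d = "CARD('n)"
    let ?C = "contact_set N0 Nb ?u"
    let ?r = "\<lambda>v x. root ?d (measure lebesgue (subdifferential ?N v x))"
    let ?S = "\<Sum>x\<in>?C. (?r v x - ?r w x) ^ ?d"
    note nodes = nodal_mesh_nodes[OF mesh]
    have C: "?C \<subseteq> N0" "finite ?C"
      using nodes(1) by (auto simp: contact_set_def)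
    \<comment> \<open>The lower bound is recorded too, since raising the upper one to the
      \<open>d\<close>-th power requires nonnegativity.\<close>
    have diff: "0 \<le> ?r ?u x" "?r ?u x \<le> ?r v x - ?r w x" if x: "x \<in> ?C" for x
    proof -
      have "x \<in> ?N" "x \<in> interior (convex hull ?N)" "convex_envelope ?N ?u x = ?u x"
        using x nodes(4) by (auto simp: contact_set_def)
      then show "?r ?u x \<le> ?r v x - ?r w x"
        using root_measure_subdifferential_diff[OF nodes(1), of x v w] w x by simp
    qed simp
    have S: "?S \<ge> 0"
      using diff by (intro sum_nonneg zero_le_power) (meson order_trans)
    have \<Omega>': "open \<Omega>" "\<Omega> \<noteq> {}" "bounded \<Omega>"
      using \<Omega> by (auto simp: uniformly_convex_domain_def)
    have D: "?D > 0"
    proof -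
      obtain x r where "r > 0" "ball x r \<subseteq> \<Omega>"
        using \<Omega>'(1,2) open_contains_ball by blast
      then show ?thesis
        using diameter_subset[OF _ \<Omega>'(3), of "ball x r"] by simp
    qed
    show "(SUP x\<in>?N. neg_part (?u x)) \<le> 1 / root ?d V * ?D * root ?d ?S"
    proof (rule cSUP_least[OF nodes(2)])
      fix x0 assume x0: "x0 \<in> ?N"
      show "neg_part (?u x0) \<le> 1 / root ?d V * ?D * root ?d ?S"
      proof (cases "?u x0 < 0")
        case False
        then show ?thesis using S D V by (simp add: neg_part_def)
      next
        case True
        \<comment> \<open>Nodes may lie on the boundary, but the closure has the same diameter as
          the domain.\<close>
        have dist: "dist y x0 \<le> ?D" if "y \<in> ?N" for y
          using diameter_bounded_bound[of "closure \<Omega>" y x0] that x0 nodes(3) \<Omega>'(3)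
          by (simp add: diameter_closure subset_iff bounded_closure) blast
        have cpt: "compact (subdifferential ?N ?u x)" if "x \<in> ?C" for x
          using compact_subdifferential[OF nodes(1)] C(1) nodes(4) that by blast
        have meas: "subdifferential ?N ?u x \<in> lmeasurable" if "x \<in> ?C" for x
          using cpt[OF that] by (rule lmeasurable_compact)
        have "V * (- ?u x0 / ?D) ^ ?d = measure lebesgue (ball 0 (- ?u x0 / ?D) :: (real ^ 'n) set)"
          using True D content_ball[of "- ?u x0 / ?D" "0 :: real ^ 'n"]
          by (simp add: V_def divide_nonpos_pos)
        also have "\<dots> \<le> measure lebesgue (\<Union>x\<in>?C. subdifferential ?N ?u x)"
        proof (rule measure_mono_fmeasurable)
          show "ball 0 (- ?u x0 / ?D) \<subseteq> (\<Union>x\<in>?C. subdifferential ?N ?u x)"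
            using ball_subset_contact_subdifferentials[where u = ?u, OF nodes(1) x0 True D dist] bd by simp
          show "(\<Union>x\<in>?C. subdifferential ?N ?u x) \<in> lmeasurable"
            using C(2) meas by (intro fmeasurable.finite_UN)
        qed simp
        \<comment> \<open>Subadditivity suffices; nothing is claimed about overlaps between the
          subdifferentials of different nodes.\<close>
        also have "\<dots> \<le> (\<Sum>x\<in>?C. measure lebesgue (subdifferential ?N ?u x))"
          using C(2) meas by (intro measure_UNION_le fmeasurableD)
        also have "\<dots> = (\<Sum>x\<in>?C. ?r ?u x ^ ?d)"
          by simp
        also have "\<dots> \<le> ?S"
          using diff by (intro sum_mono power_mono)
        finally have "root ?d (V * (- ?u x0 / ?D) ^ ?d) \<le> root ?d ?S"
          by simp
        moreover have "- ?u x0 / ?D \<ge> 0"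
          using True D by (simp add: divide_nonpos_pos)
        ultimately have "root ?d V * (- ?u x0 / ?D) \<le> root ?d ?S"
          by (simp only: real_root_mult real_root_power_cancel[OF zero_less_card_finite])
        then have "- ?u x0 \<le> 1 / root ?d V * ?D * root ?d ?S"
          using D V by (simp add: field_simps)
        then show ?thesis
          using True by (simp add: neg_part_def)
      qed
    qed
  qed
qed

end
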